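(* Let $n\in\mathbb{N}$, $n\ge 4$, and let $K_n$ be the complete graph on $n$ vertices. There exists no minimal SLSE temporal graph on $K_n$. In fact, for any SLSE labelling $L$ of $K_n$ one can remove at least $\lfloor n/4\rfloor$ labels from $L$ without violating TC.
   Context: A labelling of an undirected graph $G=(V,E)$ is an assignment $L=\{L_e\subseteq\mathbb{N}^*:e\in E\}$ of sets of positive integer labels to edges; $G(L)=(V,E,L)$ is the resulting temporal graph. An SLSE (single-label-single-edge) labelling is one in which each edge has exactly one label and no two edges have the same label; the resulting temporal graph is called an SLSE temporal graph. A $(u,v)$-journey is a sequence $(u,u_1,l_1),(u_1,u_2,l_2),\ldots,(u_{k-1},v,l_k)$ in which each consecutive pair of vertices forms an edge $e$ with the corresponding label in $L_e$, and $l_1<l_2<\cdots<l_k$. $G(L)$ satisfies TC if for every ordered pair of distinct vertices $u,v$ there is a $(u,v)$-journey. $G(L)$ is minimal if it satisfies TC and the removal of any single label from any $L_e$ results in a temporal graph that does not satisfy TC. *)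

theory Defs
  imports Main
begin

text \<open>
  A graph is given by a vertex set \<open>V\<close> and a set \<open>E\<close> of two-element subsets of \<open>V\<close>.
  Label assignments are total functions on vertex sets; all notions below only look at their
  values on members of \<open>E\<close>.
\<close>

definition complete_edges :: "'a set \<Rightarrow> 'a set set" where
  "complete_edges V = {{u, v} | u v. u \<in> V \<and> v \<in> V \<and> u \<noteq> v}"

type_synonym 'a labels = "'a set \<Rightarrow> nat set"

definition labelling :: "'a set set \<Rightarrow> 'a labels \<Rightarrow> bool" where
  "labelling E L \<longleftrightarrow> (\<forall>e\<in>E. \<forall>l\<in>L e. l > 0)"

definition slse_labelling :: "'a set set \<Rightarrow> 'a labels \<Rightarrow> bool" where
  "slse_labelling E L \<longleftrightarrow>
     labelling E L \<and>
     (\<forall>e\<in>E. \<exists>l. L e = {l}) \<and>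
     (\<forall>e\<in>E. \<forall>e'\<in>E. e \<noteq> e' \<longrightarrow> L e \<inter> L e' = {})"

definition journey :: "'a set set \<Rightarrow> 'a labels \<Rightarrow> 'a \<Rightarrow> 'a \<Rightarrow> ('a \<times> 'a \<times> nat) list \<Rightarrow> bool" where
  "journey E L u v J \<longleftrightarrow>
     J \<noteq> [] \<and>
     fst (hd J) = u \<and>
     fst (snd (last J)) = v \<and>
     (\<forall>(x, y, l)\<in>set J. {x, y} \<in> E \<and> l \<in> L {x, y}) \<and>
     (\<forall>i. Suc i < length J \<longrightarrow> fst (snd (J ! i)) = fst (J ! Suc i)) \<and>
     sorted_wrt (<) (map (\<lambda>(x, y, l). l) J)"

definition temporally_connected :: "'a set \<Rightarrow> 'a set set \<Rightarrow> 'a labels \<Rightarrow> bool" where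
  "temporally_connected V E L \<longleftrightarrow>
     (\<forall>u\<in>V. \<forall>v\<in>V. u \<noteq> v \<longrightarrow> (\<exists>J. journey E L u v J))"

text \<open>
  A single label occurrence is a pair of an edge and one of its labels, so that removing a
  label from one edge leaves equal labels on other edges in place.
\<close>

definition label_occs :: "'a set set \<Rightarrow> 'a labels \<Rightarrow> ('a set \<times> nat) set" where
  "label_occs E L = {(e, l). e \<in> E \<and> l \<in> L e}"

definition remove_labels :: "'a labels \<Rightarrow> ('a set \<times> nat) set \<Rightarrow> 'a labels" where
  "remove_labels L R = (\<lambda>e. {l \<in> L e. (e, l) \<notin> R})"

definition minimal_temporal_graph :: "'a set \<Rightarrow> 'a set set \<Rightarrow> 'a labels \<Rightarrow> bool" where
  "minimal_temporal_graph V E L \<longleftrightarrow>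
     temporally_connected V E L \<and>
     (\<forall>p\<in>label_occs E L. \<not> temporally_connected V E (remove_labels L {p}))"

end

theory Submission
  imports Defs
begin

text \<open>
  Every \<open>K\<^sub>4\<close> with six distinct labels has an edge whose two endpoints reach each other, in both
  directions, without that edge. Choosing one such edge in each of \<open>n div 4\<close> disjoint
  quadruples of vertices is harmless: the detours stay inside their own quadruple, and all other
  pairs keep their direct edge.
\<close>

text \<open>Deleting an edge stands in for deleting its labels: detours are found in a reduced edge
  set with \<open>L\<close> unchanged. This lemma later carries them to larger edge sets, and
  finally to the full edge set with a reduced labelling that agrees with \<open>L\<close> on the
  surviving edges.\<close>

lemma journey_mono:
  assumes "journey E L u v J" and "E \<subseteq> E'" and "\<And>e. e \<in> E \<Longrightarrow> L e \<subseteq> L' e"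
  shows "journey E' L' u v J"
  using assms unfolding journey_def by blast

lemma temporally_connected_mono:
  assumes "temporally_connected V E L" and "\<And>e. e \<in> E \<Longrightarrow> L e \<subseteq> L' e"
  shows "temporally_connected V E L'"
  using assms journey_mono[of E L _ _ _ E L'] unfolding temporally_connected_def by blast

lemma complete_edges_mono: "W \<subseteq> V \<Longrightarrow> complete_edges W \<subseteq> complete_edges V"
  by (auto simp: complete_edges_def)

lemma doubleton_in_complete_edges:
  "{u, v} \<in> complete_edges V \<longleftrightarrow> u \<in> V \<and> v \<in> V \<and> u \<noteq> v"
  by (auto simp: complete_edges_def doubleton_eq_iff)

lemma finite_complete_edges: "finite V \<Longrightarrow> finite (complete_edges V)"
  by (rule finite_subset[of _ "Pow V"]) (auto simp: complete_edges_def)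

lemma complete_edges_disjoint:
  "A \<inter> B = {} \<Longrightarrow> complete_edges A \<inter> complete_edges B = {}"
  by (auto simp: complete_edges_def doubleton_eq_iff)

lemma journey_one:
  assumes "{u, v} \<in> E" "l \<in> L {u, v}"
  shows "journey E L u v [(u, v, l)]"
  using assms by (simp add: journey_def)

lemma journey_two:
  assumes "{u, w} \<in> E" "{w, v} \<in> E" "a \<in> L {u, w}" "b \<in> L {w, v}" "a < b"
  shows "journey E L u v [(u, w, a), (w, v, b)]"
  using assms by (simp add: journey_def)

lemma journey_three:
  assumes "{u, w} \<in> E" "{w, x} \<in> E" "{x, v} \<in> E"
    and "a \<in> L {u, w}" "b \<in> L {w, x}" "c \<in> L {x, v}" "a < b" "b < c"
  shows "journey E L u v [(u, w, a), (w, x, b), (x, v, c)]"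
  using assms by (auto simp: journey_def nth_Cons split: nat.split)

text \<open>
  The label conditions for a journey from \<open>u\<close> to \<open>v\<close> along one of the four paths through
  \<open>w\<close> and \<open>x\<close> that avoid the edge \<open>uv\<close>; each argument is the label of the edge it is named after.
\<close>

definition detour :: "nat \<Rightarrow> nat \<Rightarrow> nat \<Rightarrow> nat \<Rightarrow> nat \<Rightarrow> bool" where
  "detour uw wv ux xv wx \<longleftrightarrow>
     uw < wv \<or> ux < xv \<or> uw < wx \<and> wx < xv \<or> ux < wx \<and> wx < wv"

text \<open>If for some edge uv the two-edge paths through w and x run in opposite directions, that
  edge violates its hypothesis. Otherwise, writing uw for the label of an edge, whether uw < vw does
  not depend on w. This relation orders the four vertices linearly, since any three of them are
  compared at the fourth. Call them p, q, r, s in that order. Then q reaches r by a two-edge path,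
  and r reaches q along r, p, s, q because pr < ps < qs, so the edge qr violates its
  hypothesis.\<close>

lemma K4_labels:
  fixes ab ac ad bc bd cd :: nat
  assumes "distinct [ab, ac, ad, bc, bd, cd]"
    and "\<not> (detour ac bc ad bd cd \<and> detour bc ac bd ad cd)"
    and "\<not> (detour ab bc ad cd bd \<and> detour bc ab cd ad bd)"
    and "\<not> (detour ab bd ac cd bc \<and> detour bd ab cd ac bc)"
    and "\<not> (detour ab ac bd cd ad \<and> detour ac ab cd bd ad)"
    and "\<not> (detour ab ad bc cd ac \<and> detour ad ab cd bc ac)"
    and "\<not> (detour ac ad bc bd ab \<and> detour ad ac bd bc ab)"
  shows False
proof -
  \<comment> \<open>The split is by the rank of \<open>ab\<close> among the labels of the triangle
    on a, b, c. Pure order reasoning on six numbers remains in each case.\<close>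
  consider "ab < ac" "ab < bc" | "ac < ab" "bc < ab" | "ac < ab" "ab < bc" | "ab < ac" "bc < ab"
    using assms(1) by fastforce
  then show False
    apply cases
    using assms unfolding detour_def apply simp_all
    apply (smt (verit) nat_neq_iff less_trans)+
    done
qed

definition bidetour :: "('a set \<Rightarrow> nat) \<Rightarrow> 'a \<Rightarrow> 'a \<Rightarrow> 'a \<Rightarrow> 'a \<Rightarrow> bool" where
  "bidetour f u v w x \<longleftrightarrow>
     detour (f {u, w}) (f {v, w}) (f {u, x}) (f {v, x}) (f {w, x}) \<and>
     detour (f {v, w}) (f {u, w}) (f {v, x}) (f {u, x}) (f {w, x})"

lemma K4_bidetour:
  assumes "distinct [f {a, b}, f {a, c}, f {a, d}, f {b, c}, f {b, d}, f {c, d}]"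
  shows "bidetour f a b c d \<or> bidetour f a c b d \<or> bidetour f a d b c \<or>
         bidetour f b c a d \<or> bidetour f b d a c \<or> bidetour f c d a b"
proof -
  have "{b, a} = {a, b}" "{c, a} = {a, c}" "{d, a} = {a, d}"
    "{c, b} = {b, c}" "{d, b} = {b, d}" "{d, c} = {c, d}"
    by auto
  then show ?thesis
    using K4_labels[OF assms] unfolding bidetour_def by metis
qed

lemma detour_journey:
  assumes "detour (f {u, w}) (f {v, w}) (f {u, x}) (f {v, x}) (f {w, x})"
    and "distinct [u, v, w, x]" and "{u, v, w, x} \<subseteq> V"
    and L: "\<And>e. e \<in> complete_edges V \<Longrightarrow> f e \<in> L e"
  shows "\<exists>J. journey (complete_edges V - {{u, v}}) L u v J"
proof -
  let ?E = "complete_edges V - {{u, v}}"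
  \<comment> \<open>The edge between \<open>w\<close> and \<open>x\<close> is listed both ways round
    because the two three-edge paths cross it in opposite directions.\<close>
  have E: "{u, w} \<in> ?E" "{u, x} \<in> ?E" "{w, v} \<in> ?E" "{x, v} \<in> ?E" "{w, x} \<in> ?E" "{x, w} \<in> ?E"
    using assms(2,3) by (auto simp: doubleton_in_complete_edges doubleton_eq_iff)
  then have F: "f {u, w} \<in> L {u, w}" "f {u, x} \<in> L {u, x}" "f {w, v} \<in> L {w, v}"
    "f {x, v} \<in> L {x, v}" "f {w, x} \<in> L {w, x}" "f {x, w} \<in> L {x, w}"
    using L by blast+
  have s: "{v, w} = {w, v}" "{v, x} = {x, v}" "{x, w} = {w, x}"
    by auto
  from assms(1) consider
      "f {u, w} < f {w, v}" | "f {u, x} < f {x, v}"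
    | "f {u, w} < f {w, x}" "f {w, x} < f {x, v}"
    | "f {u, x} < f {x, w}" "f {x, w} < f {w, v}"
    unfolding detour_def s by blast
  then show ?thesis
  proof cases
    case 1 then show ?thesis using journey_two[OF E(1,3) F(1,3)] by blast
  next
    case 2 then show ?thesis using journey_two[OF E(2,4) F(2,4)] by blast
  next
    case 3 then show ?thesis using journey_three[OF E(1,5,4) F(1,5,4)] by blast
  next
    case 4 then show ?thesis using journey_three[OF E(2,6,3) F(2,6,3)] by blast
  qed
qed

text \<open>The six labels inside \<open>Q\<close> are distinct, so \<open>K4_bidetour\<close>
  supplies \<open>e\<close>. Quantifying over all \<open>u\<close>, \<open>v\<close> with
  \<open>{u, v} = e\<close> covers both directions of travel.\<close>

lemma K4_redundant_edge:
  fixes L :: "'a labels"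
  assumes slse: "slse_labelling (complete_edges V) L" and "Q \<subseteq> V" and "card Q = 4"
  shows "\<exists>e\<in>complete_edges Q. \<forall>u v. {u, v} = e \<longrightarrow> (\<exists>J. journey (complete_edges Q - {e}) L u v J)"
proof -
  obtain a b c d where Q: "Q = {a, b, c, d}" and dist: "distinct [a, b, c, d]"
  proof -
    obtain xs where xs: "set xs = Q" "distinct xs"
      using finite_distinct_list[of Q] assms(3) by (metis card.infinite zero_neq_numeral)
    then have "length xs = 4"
      using assms(3) distinct_card by metis
    then obtain a b c d where "xs = [a, b, c, d]"
      by (auto simp: numeral_eq_Suc length_Suc_conv)
    with xs that show thesis by auto
  qed
  have "\<forall>e\<in>complete_edges V. \<exists>l. L e = {l}"
    using slse unfolding slse_labelling_def by blast
  then obtain f where f: "L e = {f e}" if "e \<in> complete_edges V" for e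
    by (metis bchoice)
  have inj: "f e = f e' \<longleftrightarrow> e = e'" if "e \<in> complete_edges V" "e' \<in> complete_edges V" for e e'
  proof -
    have "e \<noteq> e' \<Longrightarrow> {f e} \<inter> {f e'} = {}"
      using slse that f[OF that(1)] f[OF that(2)] unfolding slse_labelling_def by metis
    then show ?thesis by blast
  qed
  have "{a, b} \<in> complete_edges V" "{a, c} \<in> complete_edges V" "{a, d} \<in> complete_edges V"
    "{b, c} \<in> complete_edges V" "{b, d} \<in> complete_edges V" "{c, d} \<in> complete_edges V"
    using dist assms(2) unfolding Q by (auto simp: doubleton_in_complete_edges)
  then have "distinct [f {a, b}, f {a, c}, f {a, d}, f {b, c}, f {b, d}, f {c, d}]"
    using dist by (simp add: inj doubleton_eq_iff)
  \<comment> \<open>Whichever of the six disjuncts holds, the vertices are renamed so that the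
    redundant edge is \<open>{u, v}\<close> and the other two vertices are \<open>w\<close> and
    \<open>x\<close>.\<close>
  from K4_bidetour[OF this] obtain u v w x
    where b: "bidetour f u v w x" and d: "distinct [u, v, w, x]" and q: "Q = {u, v, w, x}"
  proof (elim disjE)
  qed (rule that, assumption, use dist Q in auto)+
  have L: "f e \<in> L e" if "e \<in> complete_edges Q" for e
    using that f complete_edges_mono[OF assms(2)] by blast
  have "\<exists>J. journey (complete_edges Q - {{u, v}}) L u v J"
    by (rule detour_journey[of f u w v x]) (use b d q L in \<open>auto simp: bidetour_def\<close>)
  moreover have "\<exists>J. journey (complete_edges Q - {{v, u}}) L v u J"
    by (rule detour_journey[of f v w u x]) (use b d q L in \<open>auto simp: bidetour_def\<close>)
  moreover have "{u, v} \<in> complete_edges Q"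
    using d q by (simp add: doubleton_in_complete_edges)
  ultimately show ?thesis
    by (intro bexI[of _ "{u, v}"]) (auto simp: doubleton_eq_iff insert_commute)
qed

text \<open>Induction on \<open>k\<close> splits one quadruple off \<open>W\<close> at a time.
  Confining the detours to edges inside \<open>W\<close> is what makes the induction work: an edge
  later chosen in a disjoint quadruple cannot lie on them.\<close>

lemma redundant_edges:
  fixes L :: "'a labels"
  assumes slse: "slse_labelling (complete_edges V) L" and "finite V"
  shows "W \<subseteq> V \<Longrightarrow> 4 * k \<le> card W \<Longrightarrow>
    \<exists>D \<subseteq> complete_edges W. card D = k \<and>
      (\<forall>u v. {u, v} \<in> D \<longrightarrow> (\<exists>J. journey (complete_edges W - D) L u v J))"
proof (induction k arbitrary: W)
  case 0
  show ?case by (intro exI[of _ "{}"]) auto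
next
  case (Suc k)
  have finW: "finite W"
    using Suc.prems(1) assms(2) finite_subset by blast
  obtain Q where Q: "Q \<subseteq> W" "card Q = 4"
    using obtain_subset_with_card_n[of 4 W] Suc.prems(2) by auto
  define W' where "W' = W - Q"
  have "card W' = card W - 4"
    unfolding W'_def using Q finW by (simp add: card_Diff_subset finite_subset)
  with Suc.prems have "W' \<subseteq> V" "4 * k \<le> card W'"
    by (auto simp: W'_def)
  from Suc.IH[OF this] obtain D where D: "D \<subseteq> complete_edges W'" "card D = k"
    and JD: "\<And>u v. {u, v} \<in> D \<Longrightarrow> \<exists>J. journey (complete_edges W' - D) L u v J"
    by blast
  have "Q \<subseteq> V"
    using Q(1) Suc.prems(1) by blast
  from K4_redundant_edge[OF slse this Q(2)] obtain e where e: "e \<in> complete_edges Q"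
    and Je: "\<And>u v. {u, v} = e \<Longrightarrow> \<exists>J. journey (complete_edges Q - {e}) L u v J"
    by blast
  \<comment> \<open>Disjointness serves three ends: \<open>e\<close> is new to \<open>D\<close>, the
    detour around \<open>e\<close> avoids \<open>D\<close>, and the detours around \<open>D\<close>
    avoid \<open>e\<close>.\<close>
  have disj: "complete_edges Q \<inter> complete_edges W' = {}"
    by (rule complete_edges_disjoint) (auto simp: W'_def)
  have sub: "complete_edges Q \<subseteq> complete_edges W" "complete_edges W' \<subseteq> complete_edges W"
    using Q(1) by (simp_all add: complete_edges_mono W'_def)
  have "finite D"
    using D(1) finite_complete_edges finW finite_subset unfolding W'_def by blast
  then have "card (insert e D) = Suc k"
    using D e disj by (subst card_insert_disjoint) auto
  moreover have "\<exists>J. journey (complete_edges W - insert e D) L u v J"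
    if "{u, v} \<in> insert e D" for u v
  proof (cases "{u, v} = e")
    case True
    have "complete_edges Q - {e} \<subseteq> complete_edges W - insert e D"
      using sub disj D(1) by blast
    then show ?thesis
      using Je[OF True] journey_mono[OF _ _ order_refl] by metis
  next
    case False
    have "complete_edges W' - D \<subseteq> complete_edges W - insert e D"
      using sub disj e by blast
    moreover have "{u, v} \<in> D"
      using False that by blast
    ultimately show ?thesis
      using JD journey_mono[OF _ _ order_refl] by metis
  qed
  moreover have "insert e D \<subseteq> complete_edges W"
    using sub D(1) e by blast
  ultimately show ?case
    by (intro exI[of _ "insert e D"]) simp
qed

lemma slse_removable_labels:
  fixes L :: "'a labels"
  assumes slse: "slse_labelling (complete_edges V) L" and "finite V"
  shows "\<exists>R \<subseteq> label_occs (complete_edges V) L. card R = card V div 4 \<and>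
    temporally_connected V (complete_edges V) (remove_labels L R)"
proof -
  obtain D where D: "D \<subseteq> complete_edges V" "card D = card V div 4"
    and J: "\<And>u v. {u, v} \<in> D \<Longrightarrow> \<exists>J. journey (complete_edges V - D) L u v J"
    using redundant_edges[OF assms, of V "card V div 4"] by auto
  \<comment> \<open>Every edge of \<open>D\<close> carries exactly one label, so \<open>R\<close>
    has one occurrence per edge and labels off \<open>D\<close> are untouched.\<close>
  define R where "R = label_occs D L"
  have "\<forall>e\<in>D. \<exists>l. L e = {l}"
    using slse D(1) unfolding slse_labelling_def by blast
  then obtain f where f: "\<And>e. e \<in> D \<Longrightarrow> L e = {f e}"
    by (metis bchoice)
  have "R = (\<lambda>e. (e, f e)) ` D"
    using f by (auto simp: R_def label_occs_def)
  then have card_R: "card R = card D"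
    by (simp add: card_image inj_on_def)
  have keep: "remove_labels L R e = L e" if "e \<notin> D" for e
    using that by (auto simp: remove_labels_def R_def label_occs_def)
  have "\<exists>J. journey (complete_edges V) (remove_labels L R) u v J"
    if "u \<in> V" "v \<in> V" "u \<noteq> v" for u v
  proof (cases "{u, v} \<in> D")
    case True
    then obtain p where "journey (complete_edges V - D) L u v p"
      using J by blast
    then have "journey (complete_edges V) (remove_labels L R) u v p"
      by (rule journey_mono) (auto simp: keep)
    then show ?thesis ..
  next
    case False
    have E: "{u, v} \<in> complete_edges V"
      using that by (simp add: doubleton_in_complete_edges)
    then obtain l where "l \<in> L {u, v}"
      using slse unfolding slse_labelling_def by blast
    then show ?thesis
      using journey_one[OF E, of l "remove_labels L R"] keep[OF False] by auto
  qed
  moreover have "R \<subseteq> label_occs (complete_edges V) L"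
    using D(1) by (auto simp: R_def label_occs_def)
  ultimately show ?thesis
    using card_R D(2) unfolding temporally_connected_def by (intro exI[of _ R]) simp
qed

theorem theorem4:
  fixes V :: "'a set" and n :: nat
  assumes "n \<ge> 4" and "finite V" and "card V = n"
  shows "(\<nexists>L. slse_labelling (complete_edges V) L \<and>
              minimal_temporal_graph V (complete_edges V) L) \<and>
         (\<forall>L. slse_labelling (complete_edges V) L \<longrightarrow>
            (\<exists>R \<subseteq> label_occs (complete_edges V) L.
               n div 4 \<le> card R \<and>
               temporally_connected V (complete_edges V) (remove_labels L R)))"
proof (intro conjI allI impI notI)
  fix L :: "'a labels"
  assume "slse_labelling (complete_edges V) L"
  from slse_removable_labels[OF this assms(2)] assms(3)
  show "\<exists>R \<subseteq> label_occs (complete_edges V) L. n div 4 \<le> card R \<and>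
      temporally_connected V (complete_edges V) (remove_labels L R)"
    by auto
next
  assume "\<exists>L. slse_labelling (complete_edges V) L \<and>
    minimal_temporal_graph V (complete_edges V) L"
  then obtain L where slse: "slse_labelling (complete_edges V) L"
    and min: "minimal_temporal_graph V (complete_edges V) L"
    by blast
  obtain R where R: "R \<subseteq> label_occs (complete_edges V) L" "card R = n div 4"
    and tc: "temporally_connected V (complete_edges V) (remove_labels L R)"
    using slse_removable_labels[OF slse assms(2)] assms(3) by blast
  \<comment> \<open>Since \<open>n\<close> is at least 4, \<open>n div 4\<close> is positive.
    Removing a single member of \<open>R\<close> keeps every label that survives the removal of all
    of \<open>R\<close>, so connectivity persists and minimality fails.\<close>
  have "R \<noteq> {}"
    using R(2) assms(1) by auto
  then obtain p where p: "p \<in> R"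
    by blast
  have "temporally_connected V (complete_edges V) (remove_labels L {p})"
    by (rule temporally_connected_mono[OF tc]) (use p in \<open>auto simp: remove_labels_def\<close>)
  with min p R(1) show False
    unfolding minimal_temporal_graph_def by blast
qed

end
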